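(* Let $(x_k)_{k=1}^{\infty}$ denote either the van der Corput sequence in base $2$ or the Kronecker sequence $x_k=\{k\phi\}$. There exists a universal constant $c>0$ so that for all $r\in\mathbb{N}$ and all $n\in\mathbb{N}$ sufficiently large (depending on $r$) and all $0\leq x\leq 1-r/n$, $$\left|\#\left\{1\leq k\leq n:\ x\leq x_k\leq x+\frac{r}{n}\right\}-r\right|\leq c\cdot\log r.$$
   Context: $\phi=(1+\sqrt5)/2$ is the golden ratio and $\{y\}=y-\lfloor y\rfloor$ denotes the fractional part of $y$. The van der Corput sequence in base $2$ is $\frac12,\frac14,\frac34,\frac18,\frac58,\frac38,\frac78,\dots$: if $k\geq1$ has binary expansion $k=\sum_{i\ge0} b_i 2^i$ with $b_i\in\{0,1\}$, then $x_k=\sum_{i\geq0}b_i2^{-i-1}$.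
   Formalization: The formal theorem takes r ≥ 2: for r = 1 the bound c·log r is 0 and the claim fails (van der Corput, n = 2^m with m ≥ 2: the interval [1/n, 2/n] contains at least two points), and for r = 0 log r is undefined. *)

theory Defs
  imports Complex_Main
begin

definition golden_ratio :: real where
  "golden_ratio = (1 + sqrt 5) / 2"

definition kronecker_golden :: "nat \<Rightarrow> real" where
  "kronecker_golden k = frac (real k * golden_ratio)"

text \<open>Only finitely many binary digits of \<open>k\<close> are nonzero, so the series below is a finite sum
  (see \<open>van_der_corput_sums\<close>).\<close>

definition van_der_corput :: "nat \<Rightarrow> real" where
  "van_der_corput k = (\<Sum>i. of_bool (bit k i) / 2 ^ (i + 1))"

lemma van_der_corput_sums:
  "(\<lambda>i. of_bool (bit k i) / 2 ^ (i + 1) :: real) sums van_der_corput k"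
  "van_der_corput k = (\<Sum>i<k. of_bool (bit k i) / 2 ^ (i + 1))"
proof -
  have *: "\<not> bit k i" if "i \<notin> {..<k}" for i
  proof -
    have "k < 2 ^ k" by (rule less_exp)
    also have "(2::nat) ^ k \<le> 2 ^ i" using that by (intro power_increasing) auto
    finally show ?thesis by (simp add: bit_iff_odd)
  qed
  have "(\<lambda>i. of_bool (bit k i) / 2 ^ (i + 1) :: real) sums
      (\<Sum>i<k. of_bool (bit k i) / 2 ^ (i + 1))"
    by (rule sums_finite) (use * in auto)
  then show "(\<lambda>i. of_bool (bit k i) / 2 ^ (i + 1) :: real) sums van_der_corput k"
    and "van_der_corput k = (\<Sum>i<k. of_bool (bit k i) / 2 ^ (i + 1))"
    unfolding van_der_corput_def by (auto simp: sums_iff)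
qed

end

theory Submission
  imports Defs "HOL-Number_Theory.Fib"
begin

text \<open>Both sequences possess, at every geometric scale \<open>\<lambda>\<^sup>m\<close> (\<open>\<lambda> = 1/2\<close> or \<open>\<lambda> = 1/\<phi>\<close>), intervals of length
  \<open>\<lambda>\<^sup>m\<close> that the first \<open>n\<close> terms hit \<open>n\<lambda>\<^sup>m\<close> times up to an error bounded uniformly in \<open>m\<close> and \<open>n\<close>.
  An interval of length \<open>r/n\<close> is a union of such intervals, boundedly many from each scale between
  \<open>r/n\<close> and \<open>1/n\<close>, and of leftovers of length \<open>O(1/n)\<close>. A leftover lies in an interval of the same
  kind at scale \<open>1/n\<close>, so it contains \<open>O(1)\<close> points. There are \<open>O(log r)\<close> scales between \<open>1/n\<close> and
  \<open>r/n\<close>, hence the total error is \<open>O(log r)\<close>; the constant term is absorbed because \<open>ln r \<ge> ln 2\<close>.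
  
  For the van der Corput sequence the intervals are the dyadic cells \<open>[i/2\<^sup>m, (i+1)/2\<^sup>m)\<close>: membership
  of the \<open>k\<close>-th term fixes the last \<open>m\<close> binary digits of \<open>k\<close>, that is, a residue class modulo \<open>2\<^sup>m\<close>
  (\<open>van_der_corput_cylinder\<close>), so the error is at most 1. A dyadic interval is
  decomposed by repeatedly rounding its endpoints to the next coarser grid
  (\<open>van_der_corput_dyadic_interval\<close>).
  
  For the rotation by \<open>\<phi>\<close> every arc of length \<open>\<phi>\<^sup>-\<^sup>m\<close> has error at most 8, wherever it lies
  (\<open>golden_arc\<close>). This length is the distance of \<open>q\<phi>\<close> from the integer \<open>fib (m + 1)\<close>, where \<open>q = fib m\<close>;
  therefore the indicator of the arc, minus its mean, is a difference of two
  fractional-part functions whose arguments differ by \<open>q\<close> steps of the rotation, and its sum over an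
  orbit telescopes to two sums over blocks of \<open>q\<close> consecutive orbit points (Kesten's
  bounded remainder phenomenon). Such a block is almost equally spaced, so each block sum is
  \<open>(q - 1)/2 + O(1)\<close> (\<open>sum_frac_near_mean\<close>). The decomposition of an interval is the greedy
  expansion of its length in powers of \<open>1/\<phi>\<close> (\<open>kronecker_excess_expansion\<close>).\<close>

section \<open>Counting errors\<close>

text \<open>Half-open intervals make the error additive; the right endpoint is restored at the very end, in
  \<open>closed_count_error\<close>.\<close>

definition excess :: "(nat \<Rightarrow> real) \<Rightarrow> nat \<Rightarrow> real \<Rightarrow> real \<Rightarrow> real" where
  "excess X n a b = real (card {k \<in> {1..n}. a \<le> X k \<and> X k < b}) - real n * (b - a)"

lemma excess_refl [simp]: "excess X n a a = 0"
proof -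
  have "{k \<in> {1..n}. a \<le> X k \<and> X k < a} = {}" by auto
  then show ?thesis by (simp only: excess_def) simp
qed

lemma excess_split:
  assumes "a \<le> b" "b \<le> c"
  shows "excess X n a c = excess X n a b + excess X n b c"
proof -
  have "{k \<in> {1..n}. a \<le> X k \<and> X k < c} =
      {k \<in> {1..n}. a \<le> X k \<and> X k < b} \<union> {k \<in> {1..n}. b \<le> X k \<and> X k < c}"
    using assms by auto
  moreover have "{k \<in> {1..n}. a \<le> X k \<and> X k < b} \<inter> {k \<in> {1..n}. b \<le> X k \<and> X k < c} = {}"
    by auto
  ultimately have "card {k \<in> {1..n}. a \<le> X k \<and> X k < c} =
      card {k \<in> {1..n}. a \<le> X k \<and> X k < b} + card {k \<in> {1..n}. b \<le> X k \<and> X k < c}"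
    by (simp add: card_Un_disjoint)
  then show ?thesis by (simp add: excess_def algebra_simps)
qed

text \<open>For intervals of length \<open>O(1/n)\<close>: the count and the expected count are then both bounded, and no
  cancellation is needed.\<close>

lemma abs_excess_le:
  assumes "a \<le> b" "{k \<in> {1..n}. a \<le> X k \<and> X k < b} \<subseteq> A" "finite A"
    and "real (card A) \<le> K" "real n * (b - a) \<le> K"
  shows "\<bar>excess X n a b\<bar> \<le> K"
proof -
  have "real (card {k \<in> {1..n}. a \<le> X k \<and> X k < b}) \<le> K"
    using card_mono[OF assms(3,2)] assms(4) by linarith
  moreover have "0 \<le> real n * (b - a)" using assms(1) by simp
  ultimately show ?thesis using assms(5) unfolding excess_def by linarith
qed

lemma closed_count_error:
  assumes "\<bar>excess X n a b\<bar> \<le> K" "real (card {k \<in> {1..n}. X k = b}) \<le> K'" "a \<le> b"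
  shows "\<bar>real (card {k. 1 \<le> k \<and> k \<le> n \<and> a \<le> X k \<and> X k \<le> b}) - real n * (b - a)\<bar> \<le> K + K'"
proof -
  have "{k. 1 \<le> k \<and> k \<le> n \<and> a \<le> X k \<and> X k \<le> b} =
      {k \<in> {1..n}. a \<le> X k \<and> X k < b} \<union> {k \<in> {1..n}. X k = b}"
    using assms(3) by auto
  moreover have "{k \<in> {1..n}. a \<le> X k \<and> X k < b} \<inter> {k \<in> {1..n}. X k = b} = {}"
    by auto
  ultimately have "card {k. 1 \<le> k \<and> k \<le> n \<and> a \<le> X k \<and> X k \<le> b} =
      card {k \<in> {1..n}. a \<le> X k \<and> X k < b} + card {k \<in> {1..n}. X k = b}"
    by (simp add: card_Un_disjoint)
  then show ?thesis using assms(1,2) unfolding excess_def by simp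
qed

lemma half_le_ln2: "1 / 2 \<le> ln (2::real)"
proof -
  have "(1::real) = ln (exp 1)" by simp
  also have "\<dots> \<le> ln (2 ^ 2)" using exp_le by (subst ln_le_cancel_iff) auto
  also have "\<dots> = 2 * ln 2" by (subst ln_realpow) auto
  finally show ?thesis by simp
qed

text \<open>The number \<open>s\<close> counts the dyadic scales between \<open>1/n\<close> and \<open>r/n\<close>.\<close>

lemma ex_power2_gt_le_ln:
  fixes r :: nat
  assumes "r \<ge> 2"
  obtains s :: nat where "r < 2 ^ s" "real s \<le> 4 * ln (real r)"
proof -
  obtain m where m: "2 ^ m \<le> r" "r < 2 ^ (m + 1)"
    using ex_power_ivl1[of 2 r] assms by auto
  have "1 \<le> m"
    using m(2) assms by (cases m) auto
  have "real m * ln 2 = ln (2 ^ m)" by (simp add: ln_realpow)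
  also have "\<dots> \<le> ln (real r)"
  proof -
    have "real (2 ^ m) \<le> real r" using m(1) by (simp only: of_nat_le_iff)
    then show ?thesis using assms by simp
  qed
  finally have "real m * ln 2 \<le> ln (real r)" .
  moreover have "real m * (1/2) \<le> real m * ln 2"
    using half_le_ln2 by (intro mult_left_mono) auto
  moreover have "1 \<le> real m" "real (m + 1) = real m + 1" using \<open>1 \<le> m\<close> by auto
  ultimately have "real (m + 1) \<le> 4 * ln (real r)" by linarith
  with m(2) show thesis by (rule that)
qed

section \<open>The van der Corput sequence\<close>

lemma van_der_corput_rec:
  "van_der_corput k = (of_bool (odd k) + van_der_corput (k div 2)) / 2"
proof -
  define f where "f i = (of_bool (bit k i) / 2 ^ (i + 1) :: real)" for i
  have "(\<lambda>i. (of_bool (bit (k div 2) i) / 2 ^ (i + 1)) / 2 :: real) sums (van_der_corput (k div 2) / 2)"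
    by (intro sums_divide van_der_corput_sums)
  also have "(\<lambda>i. (of_bool (bit (k div 2) i) / 2 ^ (i + 1)) / 2 :: real) = (\<lambda>i. f (Suc i))"
    by (simp add: f_def bit_Suc fun_eq_iff)
  finally have "f sums (van_der_corput (k div 2) / 2 + f 0)" by (rule sums_Suc)
  moreover have "f sums van_der_corput k"
    using van_der_corput_sums(1)[of k] by (simp add: f_def[abs_def])
  ultimately show ?thesis
    by (auto simp: f_def bit_0 add_divide_distrib dest: sums_unique2)
qed

lemma van_der_corput_range: "0 \<le> van_der_corput k \<and> van_der_corput k < 1"
proof (induction k rule: less_induct)
  case (less k)
  show ?case
  proof (cases "k = 0")
    case True
    then show ?thesis using van_der_corput_sums(2)[of 0] by simp
  next
    case False
    then have "k div 2 < k" by simp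
    from less[OF this] show ?thesis
      by (subst (1 2) van_der_corput_rec) (auto simp: of_bool_def)
  qed
qed

text \<open>By \<open>van_der_corput_rec\<close> the last binary digit of \<open>k\<close> decides in which half of the unit interval the
  \<open>k\<close>-th term lies, and the remaining digits place it within that half in the same way. The number
  \<open>c\<close> is the bit reversal of \<open>i\<close>.\<close>

lemma van_der_corput_cylinder:
  assumes "i < 2 ^ m"
  obtains c where "c < 2 ^ m" "\<And>k. real i / 2 ^ m \<le> van_der_corput k \<and>
      van_der_corput k < real (i + 1) / 2 ^ m \<longleftrightarrow> k mod 2 ^ m = c"
proof -
  have "\<exists>c < 2 ^ m. \<forall>k. real i / 2 ^ m \<le> van_der_corput k \<and>
      van_der_corput k < real (i + 1) / 2 ^ m \<longleftrightarrow> k mod 2 ^ m = c"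
    using assms
  proof (induction m arbitrary: i)
    case 0
    then show ?case using van_der_corput_range by simp
  next
    case (Suc m)
    define j h where "j = i mod 2 ^ m" and "h = i div 2 ^ m"
    have "j < 2 ^ m" by (simp add: j_def)
    from Suc.IH[OF this] obtain c where c: "c < 2 ^ m" "\<And>k. real j / 2 ^ m \<le> van_der_corput k \<and>
      van_der_corput k < real (j + 1) / 2 ^ m \<longleftrightarrow> k mod 2 ^ m = c" by blast
    have h: "h = 0 \<or> h = 1"
    proof -
      have "h < 2" unfolding h_def using Suc.prems by (intro less_mult_imp_div_less) simp
      then show ?thesis by auto
    qed
    have i: "i = h * 2 ^ m + j" unfolding h_def j_def by (rule div_mult_mod_eq[symmetric])
    have jle: "real (j + 1) / 2 ^ m \<le> 1"
    proof -
      have "real (j + 1) \<le> real (2 ^ m)"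
        using \<open>j < 2 ^ m\<close> by (subst of_nat_le_iff) simp
      then show ?thesis by (simp add: field_simps)
    qed
    have eq: "real i / 2 ^ Suc m = (real h + real j / 2 ^ m) / 2"
      "real (i + 1) / 2 ^ Suc m = (real h + real (j + 1) / 2 ^ m) / 2"
      by (simp_all add: i field_simps)
    have "real i / 2 ^ Suc m \<le> van_der_corput k \<and> van_der_corput k < real (i + 1) / 2 ^ Suc m
        \<longleftrightarrow> k mod 2 ^ Suc m = 2 * c + h" for k
    proof -
      let ?v = "van_der_corput (k div 2)"
      have "real i / 2 ^ Suc m \<le> van_der_corput k \<and> van_der_corput k < real (i + 1) / 2 ^ Suc m
        \<longleftrightarrow> real h + real j / 2 ^ m \<le> of_bool (odd k) + ?v \<and>
            of_bool (odd k) + ?v < real h + real (j + 1) / 2 ^ m"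
        unfolding eq van_der_corput_rec[of k]
        by (simp only: divide_le_cancel divide_less_cancel) simp
      also have "\<dots> \<longleftrightarrow> k mod 2 = h \<and> real j / 2 ^ m \<le> ?v \<and> ?v < real (j + 1) / 2 ^ m"
      proof -
        have r: "0 \<le> ?v" "?v < 1" "0 \<le> real j / 2 ^ m"
          using van_der_corput_range by auto
        show ?thesis
        proof (cases "k mod 2 = h")
          case True
          then have "of_bool (odd k) = real h" using h by (auto simp: odd_iff_mod_2_eq_one)
          then show ?thesis using True by simp
        next
          case False
          then have "of_bool (odd k) = real h + 1 \<or> of_bool (odd k) = real h - 1"
            using h by (auto simp: odd_iff_mod_2_eq_one)
          then have "\<not> (real h + real j / 2 ^ m \<le> of_bool (odd k) + ?v \<and>
              of_bool (odd k) + ?v < real h + real (j + 1) / 2 ^ m)"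
            using r jle by (elim disjE) linarith+
          then show ?thesis using False by blast
        qed
      qed
      also have "\<dots> \<longleftrightarrow> k mod 2 = h \<and> (k div 2) mod 2 ^ m = c" by (simp only: c(2))
      also have "\<dots> \<longleftrightarrow> k mod 2 ^ Suc m = 2 * c + h"
      proof -
        have "k mod 2 ^ Suc m = 2 * (k div 2 mod 2 ^ m) + k mod 2"
          by (simp add: mod_mult2_eq)
        moreover have "2 * u + v = 2 * c + h \<longleftrightarrow> v = h \<and> u = c" if "v < 2" for u v :: nat
          using h that by presburger
        ultimately show ?thesis by simp
      qed
      finally show ?thesis .
    qed
    moreover have "2 * c + h < 2 ^ Suc m" using c(1) h by auto
    ultimately show ?case by blast
  qed
  with that show thesis by blast
qed

text \<open>The case \<open>c = 0\<close> is special because the range starts at 1, which leaves out the representative 0.\<close>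

lemma card_residue_class:
  fixes q c :: nat
  assumes "c < q"
  shows "card {k \<in> {1..n}. k mod q = c} + of_bool (c = 0) = (n + q - c) div q"
proof (induction n)
  case 0
  show ?case using assms by auto
next
  case (Suc n)
  have "(Suc n + q - c) mod q = 0 \<longleftrightarrow> Suc n mod q = c"
  proof -
    have "(Suc n + q - c) mod q = 0 \<longleftrightarrow> int q dvd int (Suc n + q - c)"
      by (simp add: mod_eq_0_iff_dvd flip: int_dvd_int_iff del: of_nat_Suc)
    also have "int (Suc n + q - c) = (int (Suc n) - int c) + int q" using assms by simp
    also have "int q dvd (int (Suc n) - int c) + int q \<longleftrightarrow> int q dvd (int (Suc n) - int c)"
      by simp
    also have "\<dots> \<longleftrightarrow> int (Suc n) mod int q = int c mod int q"
      by (simp only: mod_eq_dvd_iff)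
    also have "\<dots> \<longleftrightarrow> Suc n mod q = c"
      using assms by (simp flip: of_nat_mod del: of_nat_Suc)
    finally show ?thesis .
  qed
  moreover have "Suc n + q - c = Suc (n + q - c)" using assms by simp
  ultimately have "(Suc n + q - c) div q = (n + q - c) div q + of_bool (Suc n mod q = c)"
    by (simp add: div_Suc)
  moreover have "{k \<in> {1..Suc n}. k mod q = c} =
      (if Suc n mod q = c then insert (Suc n) {k \<in> {1..n}. k mod q = c} else {k \<in> {1..n}. k mod q = c})"
    by (auto simp: le_Suc_eq)
  ultimately show ?case using Suc.IH by simp
qed

lemma van_der_corput_cell:
  assumes "i < 2 ^ m"
  shows "\<bar>excess van_der_corput n (real i / 2 ^ m) (real (i + 1) / 2 ^ m)\<bar> \<le> 1"
proof -
  define q :: nat where "q = 2 ^ m"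
  have q: "q > 0" "real q = 2 ^ m" by (auto simp: q_def)
  obtain c where c: "c < q" "\<And>k. real i / 2 ^ m \<le> van_der_corput k \<and>
      van_der_corput k < real (i + 1) / 2 ^ m \<longleftrightarrow> k mod q = c"
    using van_der_corput_cylinder[OF assms] unfolding q_def by metis
  define C where "C = card {k \<in> {1..n}. k mod q = c}"
  have C: "C + of_bool (c = 0) = (n + q - c) div q"
    unfolding C_def by (rule card_residue_class[OF c(1)])
  have lo: "real (n + q - c) / real q - 1 < real ((n + q - c) div q)"
    and hi: "real ((n + q - c) div q) \<le> real (n + q - c) / real q"
    using floor_divide_of_nat_eq[where 'a = real, of "n + q - c" q] by linarith+
  have eq: "real (n + q - c) / real q = real n / real q + 1 - real c / real q"
    using c(1) by (simp add: field_simps)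
  have "\<bar>real C - real n / real q\<bar> \<le> 1"
  proof (cases "c = 0")
    case True
    then show ?thesis using lo hi eq C by (auto simp flip: C)
  next
    case False
    have "0 \<le> real c / real q" "real c / real q < 1" using c(1) q by auto
    moreover have "C = (n + q - c) div q" using C False by simp
    ultimately show ?thesis using lo hi eq by linarith
  qed
  moreover have "excess van_der_corput n (real i / 2 ^ m) (real (i + 1) / 2 ^ m) = real C - real n / real q"
    unfolding excess_def c(2) C_def q(2) by (simp add: field_simps)
  ultimately show ?thesis by simp
qed

text \<open>Rounding both endpoints inwards to the grid of mesh \<open>2 / 2\<^sup>m\<close> cuts off at most one cell at each
  end, costing an error of at most 2, and halves the number of cells that remain.\<close>

lemma van_der_corput_dyadic_interval:
  assumes "i \<le> j" "j \<le> 2 ^ m" "j - i < 2 ^ t"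
  shows "\<bar>excess van_der_corput n (real i / 2 ^ m) (real j / 2 ^ m)\<bar> \<le> 2 * real t"
  using assms
proof (induction t arbitrary: i j m)
  case 0
  then have "i = j" by simp
  then show ?case by simp
next
  case (Suc t)
  consider "i = j" | "j = i + 1" | "j \<ge> i + 2" using Suc.prems(1) by linarith
  then show ?case
  proof cases
    case 1
    then show ?thesis by simp
  next
    case 2
    then show ?thesis using van_der_corput_cell[of i m n] Suc.prems(2) by simp
  next
    case 3
    have "m \<noteq> 0" using 3 Suc.prems(2) by (intro notI) simp
    then obtain l where m: "m = Suc l" by (cases m) auto
    define i' j' where "i' = (i + 1) div 2" and "j' = j div 2"
    have ij: "i' \<le> j'" "j' \<le> 2 ^ l" "j' - i' < 2 ^ t" "i \<le> 2 * i'" "2 * i' \<le> 2 * j'" "2 * j' \<le> j"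
      "2 * i' = i \<or> 2 * i' = i + 1" "j = 2 * j' \<or> j = 2 * j' + 1"
      using 3 Suc.prems m unfolding i'_def j'_def by auto
    have half: "real (2 * k) / 2 ^ m = real k / 2 ^ l" for k by (simp add: m)
    have mono: "real k / 2 ^ m \<le> real k' / 2 ^ m" if "k \<le> k'" for k k'
      using that by (simp add: divide_right_mono)
    let ?E = "\<lambda>k k'. excess van_der_corput n (real k / 2 ^ m) (real k' / 2 ^ m)"
    have "?E i j = ?E i (2 * i') + ?E (2 * i') j"
      using ij by (intro excess_split mono) auto
    also have "?E (2 * i') j = ?E (2 * i') (2 * j') + ?E (2 * j') j"
      using ij by (intro excess_split mono) auto
    finally have "?E i j = ?E i (2 * i') + (?E (2 * i') (2 * j') + ?E (2 * j') j)" .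
    moreover have "\<bar>?E (2 * i') (2 * j')\<bar> \<le> 2 * real t"
      unfolding half by (rule Suc.IH) (use ij in auto)
    moreover have "\<bar>?E i (2 * i')\<bar> \<le> 1"
    proof (cases "2 * i' = i")
      case False
      then have "2 * i' = i + 1" using ij(7) by simp
      then show ?thesis using van_der_corput_cell[of i m n] 3 Suc.prems(2) by (simp only:)
    qed simp
    moreover have "\<bar>?E (2 * j') j\<bar> \<le> 1"
    proof (cases "j = 2 * j'")
      case False
      then have "j = 2 * j' + 1" using ij(8) by simp
      then show ?thesis using van_der_corput_cell[of "2 * j'" m n] Suc.prems(2) by (simp only:)
    qed simp
    ultimately show ?thesis by simp
  qed
qed

lemma van_der_corput_within_cell:
  assumes "real i / 2 ^ m \<le> a" "a \<le> b" "b \<le> real (i + 1) / 2 ^ m" "b \<le> 1" "n \<le> 2 ^ m"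
  shows "\<bar>excess van_der_corput n a b\<bar> \<le> 2"
proof (cases "i < 2 ^ m")
  case True
  let ?A = "{k \<in> {1..n}. real i / 2 ^ m \<le> van_der_corput k \<and> van_der_corput k < real (i + 1) / 2 ^ m}"
  have n: "real n / 2 ^ m \<le> 1"
  proof -
    have "real n \<le> real (2 ^ m)" using assms(5) by (simp only: of_nat_le_iff)
    then show ?thesis by simp
  qed
  have "real (card ?A) - real n / 2 ^ m \<le> 1"
    using van_der_corput_cell[OF True, of n] unfolding excess_def by (simp add: field_simps)
  then have A: "real (card ?A) \<le> 2" using n by linarith
  have "real n * (b - a) \<le> real n * (1 / 2 ^ m)"
    using assms by (intro mult_left_mono) (auto simp: field_simps)
  also have "\<dots> = real n / 2 ^ m" by simp
  finally have "real n * (b - a) \<le> 2" using n by linarith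
  with A show ?thesis
    by (intro abs_excess_le[where A = ?A]) (use assms in auto)
next
  case False
  then have "real (2 ^ m) \<le> real i" by (simp only: of_nat_le_iff not_less)
  then have "1 \<le> real i / 2 ^ m" by simp
  then have "a = b" using assms by linarith
  then show ?thesis by simp
qed

lemma van_der_corput_point:
  assumes "n \<le> 2 ^ m"
  shows "real (card {k \<in> {1..n}. van_der_corput k = y}) \<le> 2"
proof (cases "0 \<le> y \<and> y < 1")
  case True
  define i where "i = nat \<lfloor>2 ^ m * y\<rfloor>"
  have "real i = of_int \<lfloor>2 ^ m * y\<rfloor>" using True by (simp add: i_def)
  then have i: "real i \<le> 2 ^ m * y" "2 ^ m * y < real i + 1" by linarith+
  have "real i < 2 ^ m" using i(1) True by (smt (verit) mult_less_cancel_left2 zero_less_power)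
  then have "real i < real (2 ^ m)" by simp
  then have im: "i < 2 ^ m" by (simp only: of_nat_less_iff)
  have n: "real n / 2 ^ m \<le> 1"
  proof -
    have "real n \<le> real (2 ^ m)" using assms by (simp only: of_nat_le_iff)
    then show ?thesis by simp
  qed
  let ?A = "{k \<in> {1..n}. real i / 2 ^ m \<le> van_der_corput k \<and> van_der_corput k < real (i + 1) / 2 ^ m}"
  have "real (card ?A) - real n / 2 ^ m \<le> 1"
    using van_der_corput_cell[OF im, of n] unfolding excess_def by (simp add: field_simps)
  moreover have "card {k \<in> {1..n}. van_der_corput k = y} \<le> card ?A"
    by (rule card_mono) (use i in \<open>auto simp: field_simps\<close>)
  ultimately show ?thesis using n by linarith
next
  case False
  then have "{k \<in> {1..n}. van_der_corput k = y} = {}"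
    using van_der_corput_range by auto
  then show ?thesis by (simp only:) simp
qed

text \<open>The interval is compared with the dyadic grid of mesh between \<open>1/(2n)\<close> and \<open>1/n\<close>: it consists of at
  most \<open>2r\<close> whole cells and of two partial cells.\<close>

lemma van_der_corput_local_discrepancy:
  assumes r: "2 \<le> r" "r < 2 ^ s" "r \<le> n" and x: "0 \<le> x" "x \<le> 1 - real r / real n"
  shows "\<bar>real (card {k. 1 \<le> k \<and> k \<le> n \<and> x \<le> van_der_corput k \<and>
           van_der_corput k \<le> x + real r / real n}) - real r\<bar> \<le> 2 * real s + 8"
proof -
  define y where "y = x + real r / real n"
  have n: "n > 0" using r by simp
  obtain m where "2 ^ m \<le> n" "n < 2 ^ (m + 1)" using ex_power_ivl1[of 2 n] n by auto
  define l where "l = m + 1"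
  have l: "n \<le> 2 ^ l" "2 ^ l \<le> 2 * n"
    using \<open>2 ^ m \<le> n\<close> \<open>n < 2 ^ (m + 1)\<close> by (auto simp: l_def)
  have "real n \<le> real (2 ^ l)" "real (2 ^ l) \<le> real (2 * n)"
    using l by (simp_all only: of_nat_le_iff)
  then have l': "real n \<le> 2 ^ l" "2 ^ l \<le> 2 * real n" by simp_all
  have y: "0 \<le> y" "y \<le> 1" using x by (auto simp: y_def)
  have gap: "2 ^ l * y = 2 ^ l * x + 2 ^ l / real n * real r" by (simp add: y_def field_simps)
  have "1 \<le> 2 ^ l / real n" "2 ^ l / real n \<le> 2" using l' n by (auto simp: field_simps)
  then have "real r \<le> 2 ^ l / real n * real r" "2 ^ l / real n * real r \<le> 2 * real r"
    using mult_right_mono[of 1 "2 ^ l / real n" "real r"]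
      mult_right_mono[of "2 ^ l / real n" 2 "real r"] by auto
  then have gap_le: "2 ^ l * y \<le> 2 ^ l * x + 2 * real r" and gap_ge: "2 ^ l * x + 2 \<le> 2 ^ l * y"
    using gap r by linarith+
  define i j where "i = nat \<lfloor>2 ^ l * x\<rfloor>" and "j = nat \<lfloor>2 ^ l * y\<rfloor>"
  have "real i = of_int \<lfloor>2 ^ l * x\<rfloor>" "real j = of_int \<lfloor>2 ^ l * y\<rfloor>"
    using x y by (auto simp: i_def j_def)
  then have i: "real i \<le> 2 ^ l * x" "2 ^ l * x < real i + 1"
    and j: "real j \<le> 2 ^ l * y" "2 ^ l * y < real j + 1" by linarith+
  have ij: "i + 1 \<le> j" using i j gap_ge by linarith
  have "2 ^ l * y \<le> 2 ^ l * 1" using y by (intro mult_left_mono) auto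
  moreover have "real (2 ^ l) = (2 ^ l :: real)" by simp
  ultimately have "real j \<le> real (2 ^ l)" using j by linarith
  then have jl: "j \<le> 2 ^ l" by (simp only: of_nat_le_iff)
  have "j - (i + 1) < 2 ^ Suc s"
  proof -
    have "real j < real (i + 1 + 2 * r)" using i j gap_le by simp
    then have "j < i + 1 + 2 * r" by (simp only: of_nat_less_iff)
    then show ?thesis using r(2) by simp
  qed
  let ?E = "excess van_der_corput n"
  have "?E x y = ?E x (real (i + 1) / 2 ^ l) + ?E (real (i + 1) / 2 ^ l) y"
    by (rule excess_split) (use i gap_ge in \<open>auto simp: field_simps\<close>)
  also have "?E (real (i + 1) / 2 ^ l) y =
      ?E (real (i + 1) / 2 ^ l) (real j / 2 ^ l) + ?E (real j / 2 ^ l) y"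
  proof (rule excess_split)
    have "real (i + 1) \<le> real j" using ij by (simp only: of_nat_le_iff)
    then show "real (i + 1) / 2 ^ l \<le> real j / 2 ^ l" by (rule divide_right_mono) simp
    show "real j / 2 ^ l \<le> y" using j by (simp add: field_simps)
  qed
  finally have "?E x y = ?E x (real (i + 1) / 2 ^ l) +
      (?E (real (i + 1) / 2 ^ l) (real j / 2 ^ l) + ?E (real j / 2 ^ l) y)" .
  moreover have "\<bar>?E (real (i + 1) / 2 ^ l) (real j / 2 ^ l)\<bar> \<le> 2 * real (Suc s)"
    by (rule van_der_corput_dyadic_interval) fact+
  moreover have "\<bar>?E x (real (i + 1) / 2 ^ l)\<bar> \<le> 2"
  proof (rule van_der_corput_within_cell[of i])
    have "real (i + 1) \<le> real (2 ^ l)" using ij jl by (subst of_nat_le_iff) simp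
    then show "real (i + 1) / 2 ^ l \<le> 1" by (simp add: field_simps)
  qed (use i l in \<open>auto simp: field_simps\<close>)
  moreover have "\<bar>?E (real j / 2 ^ l) y\<bar> \<le> 2"
    by (rule van_der_corput_within_cell[of j]) (use j y l in \<open>auto simp: field_simps\<close>)
  ultimately have "\<bar>?E x y\<bar> \<le> 2 * real s + 6" by simp
  from closed_count_error[OF this van_der_corput_point[OF l(1)]]
  show ?thesis using n by (simp add: y_def)
qed

section \<open>Rotations\<close>

text \<open>Replacing \<open>\<alpha>\<close> by \<open>p/q\<close> moves each of the \<open>q\<close> points by at most \<open>1/q\<close>, and rounding \<open>q b\<close> to an
  integer moves them by less than another \<open>1/q\<close>. After that the points are \<open>j/q\<close> for \<open>j < q\<close>, each
  once since \<open>p\<close> is invertible modulo \<open>q\<close>, and they sum to \<open>(q - 1)/2\<close>. The moves contribute at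
  most \<open>q \<cdot> 2/q = 2\<close>; in addition only the points \<open>j = 0\<close> and \<open>j = q - 1\<close> can be carried across an
  integer, which costs at most 1 for each.\<close>

lemma sum_frac_near_mean:
  fixes \<alpha> b :: real and p :: int and q :: nat
  assumes q: "q > 0" and cop: "coprime p (int q)" and approx: "\<bar>real q * \<alpha> - p\<bar> \<le> 1 / real q"
  shows "\<bar>(\<Sum>k=1..q. frac (real k * \<alpha> - b)) - (real q - 1) / 2\<bar> \<le> 4"
proof -
  define t where "t = \<lfloor>- (real q * b)\<rfloor>"
  define \<rho> where "\<rho> k = nat ((int k * p + t) mod int q)" for k :: nat
  have inj: "inj_on \<rho> {1..q}"
  proof (rule inj_onI)
    fix k l assume kl: "k \<in> {1..q}" "l \<in> {1..q}" "\<rho> k = \<rho> l"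
    have "(int k * p + t) mod int q = (int l * p + t) mod int q"
      using kl(3) q unfolding \<rho>_def by (simp add: nat_eq_iff2)
    then have "int q dvd (int k - int l) * p"
      by (simp add: mod_eq_dvd_iff algebra_simps)
    then have "int q dvd int k - int l"
      using cop by (simp add: coprime_commute coprime_dvd_mult_left_iff)
    moreover have "\<bar>int k - int l\<bar> < int q" using kl by auto
    ultimately show "k = l" using dvd_imp_le_int[of "int k - int l" "int q"] by auto
  qed
  have "\<rho> ` {1..q} \<subseteq> {..<q}" using q by (auto simp: \<rho>_def nat_less_iff)
  then have im: "\<rho> ` {1..q} = {..<q}"
    using card_image[OF inj] by (intro card_subset_eq) simp_all
  have "(\<Sum>j<q. real j) = real q * (real q - 1) / 2"
    by (induction q) (auto simp: field_simps)
  then have mean: "(\<Sum>j<q. real j / real q) = (real q - 1) / 2"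
    using q by (simp flip: sum_divide_distrib)
  have reindex: "(\<Sum>k=1..q. g (\<rho> k)) = (\<Sum>j<q. g j)" for g :: "nat \<Rightarrow> real"
    using sum.reindex[OF inj, of g] im by simp
  have diff: "\<bar>frac (real k * \<alpha> - b) - real (\<rho> k) / real q\<bar>
      \<le> 2 / real q + of_bool (\<rho> k = 0) + of_bool (\<rho> k = q - 1)" if k: "k \<in> {1..q}" for k
  proof -
    \<comment> \<open>The total displacement of the \<open>k\<close>-th point; it is in \<open>[-1/q, 2/q)\<close>.\<close>
    define \<theta> where "\<theta> = real k * \<alpha> - b - (real k * p + t) / real q"
    have "\<theta> = (- (real q * b) - t) / real q + real k * (real q * \<alpha> - p) / real q"
      using q by (simp add: \<theta>_def field_simps)
    moreover have "0 \<le> (- (real q * b) - t) / real q" "(- (real q * b) - t) / real q < 1 / real q"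
    proof -
      have "0 \<le> - (real q * b) - t" "- (real q * b) - t < 1" unfolding t_def by linarith+
      then show "0 \<le> (- (real q * b) - t) / real q" "(- (real q * b) - t) / real q < 1 / real q"
        using q by (auto intro: divide_strict_right_mono)
    qed
    moreover have "\<bar>real k * (real q * \<alpha> - p) / real q\<bar> \<le> 1 / real q"
    proof -
      have "real k * \<bar>real q * \<alpha> - p\<bar> \<le> real q * (1 / real q)"
        using k approx by (intro mult_mono) auto
      then show ?thesis using q by (auto simp: abs_mult intro!: divide_right_mono)
    qed
    moreover have "- 1 / real q = - (1 / real q)" "2 / real q = 1 / real q + 1 / real q"
      by (simp_all flip: add_divide_distrib)
    ultimately have \<theta>: "- 1 / real q \<le> \<theta>" "\<theta> < 2 / real q"
      unfolding abs_le_iff by linarith+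
    have "int k * p + t = ((int k * p + t) div int q) * int q + int (\<rho> k)"
      using q by (simp add: \<rho>_def)
    then have "real_of_int (int k * p + t) = real_of_int (((int k * p + t) div int q) * int q + int (\<rho> k))"
      by (rule arg_cong)
    then have "(real k * p + t) / real q = of_int ((int k * p + t) div int q) + real (\<rho> k) / real q"
      using q by (simp add: field_simps)
    then have shift: "real k * \<alpha> - b = (real (\<rho> k) / real q + \<theta>) + of_int ((int k * p + t) div int q)"
      by (simp add: \<theta>_def)
    have fr: "frac (real k * \<alpha> - b) = frac (real (\<rho> k) / real q + \<theta>)"
      unfolding shift by (simp add: frac_def)
    have "\<rho> k < q" using im k by auto
    then have u: "real (\<rho> k) / real q < 1" "0 \<le> real (\<rho> k) / real q" using q by auto
    consider "\<rho> k = 0 \<or> \<rho> k = q - 1" | "\<rho> k \<ge> 1" "\<rho> k + 2 \<le> q" using \<open>\<rho> k < q\<close> by linarith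
    then show ?thesis
    proof cases
      case 1
      have "\<bar>frac (real k * \<alpha> - b) - real (\<rho> k) / real q\<bar> \<le> 1"
        using u frac_lt_1[of "real k * \<alpha> - b"] frac_ge_0[of "real k * \<alpha> - b"] by linarith
      moreover have "0 \<le> 2 / real q" by simp
      moreover have "of_bool (\<rho> k = 0) + of_bool (\<rho> k = q - 1) \<ge> (1::real)" using 1 by auto
      ultimately show ?thesis by linarith
    next
      case 2
      have "1 / real q \<le> real (\<rho> k) / real q" using 2 by (intro divide_right_mono) auto
      then have "0 \<le> real (\<rho> k) / real q + \<theta>" using \<theta> by simp
      moreover have "real (\<rho> k) / real q + \<theta> < 1"
      proof -
        have "real (\<rho> k) + 2 \<le> real q" using 2 by linarith
        then have "real (\<rho> k) / real q + 2 / real q \<le> 1" using q by (simp add: field_simps)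
        then show ?thesis using \<theta> by linarith
      qed
      ultimately have "frac (real k * \<alpha> - b) = real (\<rho> k) / real q + \<theta>"
        unfolding fr by (simp add: frac_eq)
      then show ?thesis using \<theta> by auto
    qed
  qed
  have "\<bar>(\<Sum>k=1..q. frac (real k * \<alpha> - b)) - (real q - 1) / 2\<bar>
      = \<bar>\<Sum>k=1..q. frac (real k * \<alpha> - b) - real (\<rho> k) / real q\<bar>"
    using reindex[of "\<lambda>j. real j / real q"] mean by (simp only: sum_subtractf)
  also have "\<dots> \<le> (\<Sum>k=1..q. 2 / real q + of_bool (\<rho> k = 0) + of_bool (\<rho> k = q - 1))"
    by (rule order_trans[OF sum_abs sum_mono]) (rule diff)
  also have "\<dots> = (\<Sum>j<q. 2 / real q + of_bool (j = 0) + of_bool (j = q - 1))"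
    by (rule reindex)
  also have "\<dots> = 4"
    using q by (simp add: sum.distrib of_bool_def)
  finally show ?thesis .
qed

text \<open>The indicator of an arc of the circle, minus its mean, is a coboundary for the rotation by \<open>\<delta>\<close>.\<close>

lemma of_bool_frac_less:
  fixes y \<delta> :: real
  assumes "0 \<le> \<delta>" "\<delta> \<le> 1"
  shows "of_bool (frac y < \<delta>) - \<delta> = frac (y - \<delta>) - frac y"
proof (cases "frac y < \<delta>")
  case True
  have "frac (y - \<delta>) = frac y - \<delta> + 1"
  proof -
    have "y - \<delta> - (frac y - \<delta> + 1) = of_int (\<lfloor>y\<rfloor> - 1)" by (simp add: frac_def)
    then have "y - \<delta> - (frac y - \<delta> + 1) \<in> \<int>" by (metis Ints_of_int)
    moreover have "0 \<le> frac y - \<delta> + 1" "frac y - \<delta> + 1 < 1"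
      using True assms frac_ge_0[of y] by linarith+
    ultimately show ?thesis by (simp only: frac_unique_iff)
  qed
  then show ?thesis using True by simp
next
  case False
  have "frac (y - \<delta>) = frac y - \<delta>"
  proof -
    have "y - \<delta> - (frac y - \<delta>) \<in> \<int>" by (simp add: frac_def)
    moreover have "0 \<le> frac y - \<delta>" "frac y - \<delta> < 1"
      using False assms frac_lt_1[of y] by linarith+
    ultimately show ?thesis by (simp only: frac_unique_iff)
  qed
  then show ?thesis using False by simp
qed

lemma sum_shift_difference:
  fixes g :: "nat \<Rightarrow> real"
  shows "(\<Sum>k=1..n. g k - g (k + q)) = (\<Sum>k=1..q. g k) - (\<Sum>k=1..q. g (n + k))"
proof (induction n)
  case 0
  show ?case by simp
next
  case (Suc n)
  have "(\<Sum>k=1..q. g (n + k)) + g (n + q + 1) = g (n + 1) + (\<Sum>k=1..q. g (Suc n + k))"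
    by (induction q) (auto simp: algebra_simps)
  then show ?case using Suc.IH by simp
qed

text \<open>Modulo 1, the rotation by \<open>\<delta>\<close> is the \<open>q\<close>-th iterate of the rotation by \<open>\<alpha>\<close> or its inverse, according
  to the sign of \<open>q \<alpha> - p\<close>. So the coboundary of \<open>of_bool_frac_less\<close> telescopes along the orbit with
  step \<open>q\<close>, leaving two blocks of length \<open>q\<close>, each within 4 of the same value.\<close>

lemma rotation_bounded_remainder_arc:
  fixes \<alpha> a :: real and p :: int and q n :: nat
  defines "\<delta> \<equiv> \<bar>real q * \<alpha> - p\<bar>"
  assumes q: "q > 0" and cop: "coprime p (int q)" and approx: "\<delta> \<le> 1 / real q"
  shows "\<bar>real (card {k \<in> {1..n}. frac (real k * \<alpha> - a) < \<delta>}) - real n * \<delta>\<bar> \<le> 8"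
proof -
  have "1 / real q \<le> 1" using q by simp
  then have \<delta>: "0 \<le> \<delta>" "\<delta> \<le> 1" using approx by (auto simp: \<delta>_def)
  have near: "\<bar>(\<Sum>k=1..q. frac (real k * \<alpha> - b)) - (real q - 1) / 2\<bar> \<le> 4" for b
    using sum_frac_near_mean[OF q cop] approx unfolding \<delta>_def by blast
  have tel: "\<bar>\<Sum>k=1..n. frac (real k * \<alpha> - b) - frac (real (k + q) * \<alpha> - b)\<bar> \<le> 8" for b
  proof -
    have "(\<Sum>k=1..n. frac (real k * \<alpha> - b) - frac (real (k + q) * \<alpha> - b)) =
        (\<Sum>k=1..q. frac (real k * \<alpha> - b)) - (\<Sum>k=1..q. frac (real (n + k) * \<alpha> - b))"
      by (rule sum_shift_difference)
    also have "(\<Sum>k=1..q. frac (real (n + k) * \<alpha> - b)) =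
        (\<Sum>k=1..q. frac (real k * \<alpha> - (b - real n * \<alpha>)))"
      by (simp add: algebra_simps)
    finally show ?thesis using near[of b] near[of "b - real n * \<alpha>"] by linarith
  qed
  have "real (card {k \<in> {1..n}. frac (real k * \<alpha> - a) < \<delta>}) =
      (\<Sum>k=1..n. of_bool (frac (real k * \<alpha> - a) < \<delta>))"
    by (subst sum_of_bool_eq) (auto simp: Int_def)
  then have "real (card {k \<in> {1..n}. frac (real k * \<alpha> - a) < \<delta>}) - real n * \<delta> =
      (\<Sum>k=1..n. of_bool (frac (real k * \<alpha> - a) < \<delta>) - \<delta>)"
    by (simp add: sum_subtractf)
  also have "\<dots> = (\<Sum>k=1..n. frac (real k * \<alpha> - a - \<delta>) - frac (real k * \<alpha> - a))"
    by (simp only: of_bool_frac_less[OF \<delta>])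
  also have "\<bar>\<dots>\<bar> \<le> 8"
  proof (cases "real q * \<alpha> - p \<ge> 0")
    case True
    have "frac (real k * \<alpha> - a - \<delta>) = frac (real k * \<alpha> - (a + real q * \<alpha>))" for k
    proof -
      have "real k * \<alpha> - a - \<delta> = (real k * \<alpha> - (a + real q * \<alpha>)) + of_int p"
        using True by (simp add: \<delta>_def)
      then show ?thesis by (simp only: frac_add_of_int_right)
    qed
    moreover have "frac (real k * \<alpha> - a) = frac (real (k + q) * \<alpha> - (a + real q * \<alpha>))" for k
      by (simp add: algebra_simps)
    ultimately show ?thesis using tel[of "a + real q * \<alpha>"] by (simp only:)
  next
    case False
    have "frac (real k * \<alpha> - a - \<delta>) = frac (real (k + q) * \<alpha> - a)" for k
    proof -
      have "real k * \<alpha> - a - \<delta> = (real (k + q) * \<alpha> - a) - of_int p"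
        using False by (simp add: \<delta>_def algebra_simps)
      then show ?thesis by (simp only: frac_def floor_diff_of_int of_int_diff)
    qed
    then show ?thesis using tel[of a]
      by (simp only: sum_subtractf abs_minus_commute)
  qed
  finally show ?thesis .
qed

section \<open>The golden rotation\<close>

text \<open>The reciprocal \<open>1/\<phi>\<close>, which equals \<open>\<phi> - 1\<close>; its negative is the algebraic conjugate of \<open>\<phi>\<close>.\<close>

definition inv_golden :: real where
  "inv_golden = golden_ratio - 1"

lemma inv_golden_bounds: "1 / 2 < inv_golden" "inv_golden < 1"
proof -
  have "2 < sqrt (5::real)" by (rule real_less_rsqrt) simp
  moreover have "sqrt (5::real) < 3" by (rule real_less_lsqrt) simp_all
  ultimately show "1 / 2 < inv_golden" "inv_golden < 1"
    by (auto simp: inv_golden_def golden_ratio_def)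
qed

lemma inv_golden_sq: "inv_golden * inv_golden = 1 - inv_golden"
  by (simp add: inv_golden_def golden_ratio_def field_simps)

lemma fib_golden: "real (fib m) * golden_ratio - real (fib (Suc m)) = - ((- inv_golden) ^ m)"
proof (induction m rule: fib.induct)
  case (3 m)
  have "(- inv_golden) ^ Suc (Suc m) = (- inv_golden) ^ m * (inv_golden * inv_golden)"
    by simp
  also have "\<dots> = (- inv_golden) ^ Suc m + (- inv_golden) ^ m"
    unfolding inv_golden_sq by (simp add: algebra_simps)
  finally show ?case using 3 by (simp add: algebra_simps)
qed (auto simp: inv_golden_def)

text \<open>The quality of approximation required by \<open>rotation_bounded_remainder_arc\<close>, in view of \<open>fib_golden\<close>.\<close>

lemma fib_mult_inv_golden_le: "real (fib m) * inv_golden ^ m \<le> 1"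
proof -
  have "real (fib m) * inv_golden ^ m \<le> 1 \<and> real (fib (Suc m)) * inv_golden ^ Suc m \<le> 1"
  proof (induction m)
    case 0
    show ?case using inv_golden_bounds by simp
  next
    case (Suc m)
    have "real (fib (Suc (Suc m))) * inv_golden ^ Suc (Suc m) =
        inv_golden * (real (fib (Suc m)) * inv_golden ^ Suc m) +
        (inv_golden * inv_golden) * (real (fib m) * inv_golden ^ m)"
      by (simp add: algebra_simps)
    also have "\<dots> \<le> inv_golden * 1 + (inv_golden * inv_golden) * 1"
      using Suc inv_golden_bounds by (intro add_mono mult_left_mono) auto
    also have "\<dots> = 1" unfolding inv_golden_sq by simp
    finally show ?case using Suc by blast
  qed
  then show ?thesis ..
qed

lemma golden_arc:
  assumes "m > 0"
  shows "\<bar>real (card {k \<in> {1..n}. frac (real k * golden_ratio - a) < inv_golden ^ m})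
           - real n * inv_golden ^ m\<bar> \<le> 8"
proof -
  have d: "\<bar>real (fib m) * golden_ratio - of_int (int (fib (Suc m)))\<bar> = inv_golden ^ m"
    using inv_golden_bounds fib_golden[of m] by (simp add: power_abs)
  have q: "fib m > 0" using assms by (simp add: fib_neq_0_nat)
  have "inv_golden ^ m \<le> 1 / real (fib m)"
    using fib_mult_inv_golden_le[of m] q by (simp add: field_simps)
  moreover have "coprime (int (fib (Suc m))) (int (fib m))"
    using coprime_fib_Suc_nat[of m] by (simp add: coprime_commute)
  ultimately show ?thesis
    using rotation_bounded_remainder_arc[of "fib m" "int (fib (Suc m))" golden_ratio n a] q
    unfolding d by blast
qed

text \<open>Arcs of the circle that do not pass 0 are intervals; this transfers \<open>golden_arc\<close> to the sequence.\<close>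

lemma kronecker_in_interval_iff:
  assumes "0 \<le> a" "0 \<le> d" "a + d \<le> 1"
  shows "a \<le> kronecker_golden k \<and> kronecker_golden k < a + d \<longleftrightarrow>
    frac (real k * golden_ratio - a) < d"
proof -
  define y where "y = real k * golden_ratio"
  have y: "0 \<le> frac y" "frac y < 1" by (simp_all add: frac_lt_1)
  show ?thesis
  proof (cases "a \<le> frac y")
    case True
    have "frac (y - a) = frac y - a"
      using True assms y by (subst frac_unique_iff) (auto simp: frac_def)
    then show ?thesis using True unfolding kronecker_golden_def y_def[symmetric] by auto
  next
    case False
    have "y - a - (frac y - a + 1) = of_int (\<lfloor>y\<rfloor> - 1)" by (simp add: frac_def)
    then have "y - a - (frac y - a + 1) \<in> \<int>" by (metis Ints_of_int)
    moreover have "0 \<le> frac y - a + 1" "frac y - a + 1 < 1"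
      using False assms y by linarith+
    ultimately have "frac (y - a) = frac y - a + 1" by (simp only: frac_unique_iff)
    moreover have "\<not> frac y - a + 1 < d" using assms y by linarith
    ultimately show ?thesis using False unfolding kronecker_golden_def y_def[symmetric] by simp
  qed
qed

lemma kronecker_excess_power:
  assumes "m > 0" "0 \<le> a" "a + inv_golden ^ m \<le> 1"
  shows "\<bar>excess kronecker_golden n a (a + inv_golden ^ m)\<bar> \<le> 8"
  using golden_arc[OF assms(1), of n a] inv_golden_bounds
  kronecker_in_interval_iff[of a "inv_golden ^ m"] assms
  unfolding excess_def by simp

text \<open>Greedy expansion of \<open>b - a\<close> in powers of \<open>1/\<phi>\<close> down to the exponent \<open>M\<close>, where the arcs have
  length of order \<open>1/n\<close>. Each of the \<open>t\<close> scales is used at most once: if \<open>\<beta> = 1/\<phi>\<close>, a length between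
  \<open>\<beta>\<^sup>m\<^sup>+\<^sup>1\<close> and \<open>\<beta>\<^sup>m\<close> leaves less than \<open>\<beta>\<^sup>m - \<beta>\<^sup>m\<^sup>+\<^sup>1 = \<beta>\<^sup>m\<^sup>+\<^sup>2\<close> once \<open>\<beta>\<^sup>m\<^sup>+\<^sup>1\<close> is removed. What
  is left in the end lies in one arc of length \<open>\<beta>\<^sup>M\<close>, which contains at most \<open>2 + 8\<close> points.\<close>

lemma kronecker_excess_expansion:
  assumes "real n * inv_golden ^ M \<le> 2" "t \<le> M" "M > 0"
    and "0 \<le> a" "a \<le> b" "b \<le> 1" "b - a < inv_golden ^ (M - t)"
  shows "\<bar>excess kronecker_golden n a b\<bar> \<le> 8 * real t + 10"
  using assms(2,4-)
proof (induction t arbitrary: a)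
  case 0
  let ?A = "{k \<in> {1..n}. frac (real k * golden_ratio - a) < inv_golden ^ M}"
  have "real (card ?A) \<le> 10" using golden_arc[OF \<open>M > 0\<close>, of n a] assms(1) by linarith
  moreover have "real n * (b - a) \<le> real n * inv_golden ^ M"
    using 0 by (intro mult_left_mono) auto
  ultimately have "\<bar>excess kronecker_golden n a b\<bar> \<le> 10"
    using 0 assms(1) kronecker_in_interval_iff[of a "b - a"]
    by (intro abs_excess_le[where A = ?A]) auto
  then show ?case by simp
next
  case (Suc t)
  define m where "m = M - Suc t"
  have m: "M - t = Suc m" using Suc.prems by (simp add: m_def)
  show ?case
  proof (cases "b - a < inv_golden ^ Suc m")
    case True
    then show ?thesis using Suc.IH[of a] Suc.prems m by simp
  next
    case False
    define a' where "a' = a + inv_golden ^ Suc m"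
    have pos: "0 < inv_golden ^ Suc m" using inv_golden_bounds by simp
    have "inv_golden ^ m = inv_golden ^ Suc m + inv_golden ^ m * (inv_golden * inv_golden)"
      unfolding inv_golden_sq by (simp add: algebra_simps)
    also have "inv_golden ^ m * (inv_golden * inv_golden) = inv_golden ^ Suc m * inv_golden"
      by simp
    also have "\<dots> < inv_golden ^ Suc m * 1"
      using pos inv_golden_bounds by (intro mult_strict_left_mono) auto
    finally have "b - a' < inv_golden ^ Suc m"
      using Suc.prems(5) by (simp add: a'_def m_def[symmetric])
    then have "\<bar>excess kronecker_golden n a' b\<bar> \<le> 8 * real t + 10"
      using Suc.IH[of a'] Suc.prems m pos False by (simp add: a'_def)
    moreover have "\<bar>excess kronecker_golden n a a'\<bar> \<le> 8"
      unfolding a'_def using False Suc.prems by (intro kronecker_excess_power) auto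
    moreover have "excess kronecker_golden n a b =
        excess kronecker_golden n a a' + excess kronecker_golden n a' b"
      using False pos by (intro excess_split) (auto simp: a'_def)
    ultimately show ?thesis by simp
  qed
qed

lemma kronecker_point:
  assumes "real n * inv_golden ^ M \<le> 2" "M > 0"
  shows "real (card {k \<in> {1..n}. kronecker_golden k = y}) \<le> 10"
proof -
  have "frac (real k * golden_ratio - y) < inv_golden ^ M" if "kronecker_golden k = y" for k
  proof -
    have "frac (real k * golden_ratio - y) = 0"
      using that by (auto simp: kronecker_golden_def frac_def)
    then show ?thesis using inv_golden_bounds by (simp only:) simp
  qed
  then have "card {k \<in> {1..n}. kronecker_golden k = y}
      \<le> card {k \<in> {1..n}. frac (real k * golden_ratio - y) < inv_golden ^ M}"
    by (intro card_mono) auto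
  then show ?thesis using golden_arc[OF assms(2), of n y] assms(1) by linarith
qed

text \<open>As \<open>\<phi>\<^sup>2 \<ge> 2\<close>, the ratio \<open>r < 2\<^sup>s\<close> between the lengths \<open>r/n\<close> and \<open>1/n\<close> is bridged by \<open>2s\<close> powers of
  \<open>\<phi>\<close>. The lower bound on \<open>n\<close> ensures that all the scales involved are at most 1.\<close>

lemma kronecker_local_discrepancy:
  assumes r: "2 \<le> r" "r < 2 ^ s" and n: "1 / inv_golden ^ (2 * s) \<le> real n"
    and x: "0 \<le> x" "x \<le> 1 - real r / real n"
  shows "\<bar>real (card {k. 1 \<le> k \<and> k \<le> n \<and> x \<le> kronecker_golden k \<and>
           kronecker_golden k \<le> x + real r / real n}) - real r\<bar> \<le> 16 * real s + 20"
proof -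
  note g = inv_golden_bounds
  have n1: "1 \<le> real n * inv_golden ^ (2 * s)" using n g by (simp add: field_simps)
  then have n0: "n > 0" by (intro gr0I) auto
  \<comment> \<open>The smallest scale is the last power \<open>\<phi>\<^sup>-\<^sup>M\<close> that is at least \<open>1/n\<close>.\<close>
  define P where "P m \<longleftrightarrow> real n * inv_golden ^ m < 1" for m
  obtain m0 where "inv_golden ^ m0 < 1 / real n"
    using real_arch_pow_inv[of "1 / real n" inv_golden] n0 g by auto
  then have "P m0" using n0 by (simp add: P_def field_simps)
  moreover have "\<not> P 0" using n0 by (simp add: P_def)
  ultimately obtain M where M: "\<And>i. i \<le> M \<Longrightarrow> \<not> P i" "P (Suc M)"
    using ex_least_nat_less[of P m0] by blast
  have lo: "1 \<le> real n * inv_golden ^ M" using M(1)[of M] by (simp add: P_def)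
  have hi: "real n * inv_golden ^ M \<le> 2"
  proof -
    have "real n * inv_golden ^ M * (1 / 2) \<le> real n * inv_golden ^ M * inv_golden"
      using lo g by (intro mult_left_mono) auto
    also have "\<dots> < 1" using M(2) by (simp add: P_def mult_ac)
    finally show ?thesis by simp
  qed
  have sM: "2 * s \<le> M"
  proof (rule ccontr)
    assume "\<not> 2 * s \<le> M"
    then have "inv_golden ^ (2 * s) \<le> inv_golden ^ Suc M"
      using g by (intro power_decreasing) auto
    then have "real n * inv_golden ^ (2 * s) \<le> real n * inv_golden ^ Suc M"
      by (intro mult_left_mono) auto
    then show False using n1 M(2) by (simp add: P_def)
  qed
  have "s > 0" using r by (intro gr0I) auto
  then have M0: "M > 0" using sM by simp
  have "real r / real n < inv_golden ^ (M - 2 * s)"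
  proof -
    have "inv_golden ^ (2 * s) \<le> (1 / 2) ^ s"
      unfolding power_mult power2_eq_square inv_golden_sq
      using g by (intro power_mono) auto
    then have "inv_golden ^ (M - 2 * s) * inv_golden ^ (2 * s) \<le> inv_golden ^ (M - 2 * s) * (1 / 2) ^ s"
      using g by (intro mult_left_mono) auto
    also have "inv_golden ^ (M - 2 * s) * inv_golden ^ (2 * s) = inv_golden ^ M"
      using sM by (simp flip: power_add)
    finally have "2 ^ s * inv_golden ^ M \<le> inv_golden ^ (M - 2 * s)"
      by (simp add: field_simps)
    moreover have "real r < real (2 ^ s)" using r(2) by (simp only: of_nat_less_iff)
    then have "real r / real n < 2 ^ s * (1 / real n)" using n0 by (simp add: field_simps)
    moreover have "2 ^ s * (1 / real n) \<le> 2 ^ s * inv_golden ^ M"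
      using lo n0 by (intro mult_left_mono) (auto simp: field_simps)
    ultimately show ?thesis by linarith
  qed
  then have "\<bar>excess kronecker_golden n x (x + real r / real n)\<bar> \<le> 8 * real (2 * s) + 10"
    using x by (intro kronecker_excess_expansion[OF hi sM M0]) auto
  from closed_count_error[OF this kronecker_point[OF hi M0]]
  show ?thesis using n0 by simp
qed

theorem theorem3:
  "\<exists>c::real. c > 0 \<and>
     (\<forall>X \<in> {van_der_corput, kronecker_golden}. \<forall>r::nat. r \<ge> 2 \<longrightarrow>
       (\<forall>\<^sub>F n in sequentially. \<forall>x::real. 0 \<le> x \<and> x \<le> 1 - real r / real n \<longrightarrow>
         \<bar>real (card {k::nat. 1 \<le> k \<and> k \<le> n \<and> x \<le> X k \<and> X k \<le> x + real r / real n}) - real r\<bar>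
           \<le> c * ln (real r)))"
proof (intro exI[of _ "104 :: real"] conjI ballI allI impI)
  fix X and r :: nat
  assume X: "X \<in> {van_der_corput, kronecker_golden}" and r: "2 \<le> r"
  obtain s where s: "r < 2 ^ s" "real s \<le> 4 * ln (real r)"
    using ex_power2_gt_le_ln[OF r] .
  have "1 / 2 \<le> ln (real r)"
  proof -
    have "ln 2 \<le> ln (real r)" using r by simp
    then show ?thesis using half_le_ln2 by linarith
  qed
  \<comment> \<open>\<open>104 = 16 \<cdot> 4 + 20 \<cdot> 2\<close>, from \<open>s \<le> 4 ln r\<close> and \<open>1 \<le> 2 ln r\<close>\<close>
  then have K: "2 * real s + 8 \<le> 104 * ln (real r)" "16 * real s + 20 \<le> 104 * ln (real r)"
    using s(2) by linarith+
  have "\<forall>\<^sub>F n in sequentially. r \<le> n \<and> 1 / inv_golden ^ (2 * s) \<le> real n"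
    using eventually_ge_at_top[of r]
      eventually_ge_at_top[of "nat \<lceil>1 / inv_golden ^ (2 * s)\<rceil>"]
    by eventually_elim linarith
  then show "\<forall>\<^sub>F n in sequentially. \<forall>x::real. 0 \<le> x \<and> x \<le> 1 - real r / real n \<longrightarrow>
         \<bar>real (card {k::nat. 1 \<le> k \<and> k \<le> n \<and> x \<le> X k \<and> X k \<le> x + real r / real n}) - real r\<bar>
           \<le> 104 * ln (real r)"
  proof eventually_elim
    case (elim n)
    have "\<bar>real (card {k::nat. 1 \<le> k \<and> k \<le> n \<and> x \<le> X k \<and> X k \<le> x + real r / real n}) - real r\<bar>
        \<le> 104 * ln (real r)" if x: "0 \<le> x" "x \<le> 1 - real r / real n" for x
    proof (cases "X = van_der_corput")
      case True
      show ?thesis unfolding True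
        by (rule order_trans[OF van_der_corput_local_discrepancy[OF r s(1) _ x] K(1)]) (use elim in simp)
    next
      case False
      then have X: "X = kronecker_golden" using X by simp
      show ?thesis unfolding X
        by (rule order_trans[OF kronecker_local_discrepancy[OF r s(1) _ x] K(2)]) (use elim in simp)
    qed
    then show ?case by blast
  qed
qed simp

end
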